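(* For every $n,\Delta\in\mathbb Z$ with $n\ge2$, $\Delta\ge2$, and every $\epsilon\in(0,\frac12)$, there exists an instance of (IQP) in $n$ variables with subdeterminant $\Delta$ and $k=1$ for which $$\delta^\star_\epsilon\ \ge\ \frac{(n-1)\Delta-1}{\epsilon}-2\quad\in\ \Omega\left(\frac{n\Delta}{\epsilon}\right),$$ where $$\delta^\star_\epsilon:=\min\{\|x^\star-x^d\|_\infty : x^d \text{ optimal solution to (IQP)},\ x^\star\ \epsilon\text{-approximate solution to (QP)}\}$$ and (QP) is the continuous problem corresponding to (IQP).
   Context: An instance of (IQP) is a problem $\min\{f(x): Ax\le b,\ x\in\mathbb Z^n\}$ with $f(x)=\sum_{i=1}^k -q_i x_i^2+h^{\mathsf T}x$, where $0\le k\le n$, $q_i>0$ for $i=1,\dots,k$, $A$ is an integer matrix with $n$ columns, and $q_i$, $h$, $b$ are real. The corresponding (QP) is $\min\{f(x): Ax\le b,\ x\in\mathbb R^n\}$. The instance has subdeterminant $\Delta$ if the maximum of the absolute values of the subdeterminants (determinants of square submatrices) of $A$ is $\Delta$. $\epsilon$-approximate solution: for a problem $\min\{f(x): x\in S\}$, $S\subseteq\mathbb R^n$, having an optimal solution $x^{\mathrm{opt}}$, let $f_{\max}$ be the maximum value of $f$ on $S$. For $\epsilon\in[0,1]$, a feasible point $x^*\in S$ is an $\epsilon$-approximate solution if $f(x^* )-f(x^{\mathrm{opt}})\le\epsilon\,(f_{\max}-f(x^{\mathrm{opt}}))$. If $f$ is unbounded above on $S$, every feasible point is an $\epsilon$-approximate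 solution for every $\epsilon>0$. The definition of $\delta^\star_\epsilon$ is for instances in which both (IQP) and (QP) have an optimal solution (which is part of what is asserted to exist). The notation $g\in\Omega(h)$ means there are constants $c,C>0$, independent of $n,\Delta,\epsilon$, with $g\ge c\,h$ whenever $h\ge C$. *)

theory Defs
  imports
    Complex_Main
    "Jordan_Normal_Form.Determinant"
    "Jordan_Normal_Form.DL_Submatrix"
begin

text \<open>
  Data of an optimization problem over the polyhedron $Ax \le b$.  The number $k$ of concave
  terms is the dimension of the vector \<open>quad\<close>; indices start at 0.
\<close>

record iqp =
  quad :: "real vec"
  lin :: "real vec"
  cmat :: "int mat"
  rhs :: "real vec"

definition iqp_instance :: "nat \<Rightarrow> nat \<Rightarrow> iqp \<Rightarrow> bool" where
  "iqp_instance n k P \<longleftrightarrow>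
     k \<le> n \<and> quad P \<in> carrier_vec k \<and> (\<forall>i<k. quad P $ i > 0) \<and>
     lin P \<in> carrier_vec n \<and>
     (\<exists>m. cmat P \<in> carrier_mat m n \<and> rhs P \<in> carrier_vec m)"

definition objective :: "iqp \<Rightarrow> real vec \<Rightarrow> real" where
  "objective P x = (\<Sum>i<dim_vec (quad P). - (quad P $ i) * (x $ i)\<^sup>2) + lin P \<bullet> x"

definition qp_feasible :: "iqp \<Rightarrow> real vec set" where
  "qp_feasible P =
     {x \<in> carrier_vec (dim_col (cmat P)). map_mat real_of_int (cmat P) *\<^sub>v x \<le> rhs P}"

definition iqp_feasible :: "iqp \<Rightarrow> real vec set" where
  "iqp_feasible P = {x \<in> qp_feasible P. \<forall>i<dim_vec x. x $ i \<in> \<int>}"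

definition subdeterminants :: "int mat \<Rightarrow> int set" where
  "subdeterminants A =
     {det (submatrix A I J) | I J.
        I \<subseteq> {..<dim_row A} \<and> J \<subseteq> {..<dim_col A} \<and> card I = card J \<and> I \<noteq> {}}"

definition has_subdeterminant :: "iqp \<Rightarrow> int \<Rightarrow> bool" where
  "has_subdeterminant P \<Delta> \<longleftrightarrow>
     \<Delta> \<in> abs ` subdeterminants (cmat P) \<and> (\<forall>d \<in> subdeterminants (cmat P). \<bar>d\<bar> \<le> \<Delta>)"

definition optimal_solution :: "('a \<Rightarrow> real) \<Rightarrow> 'a set \<Rightarrow> 'a \<Rightarrow> bool" where
  "optimal_solution f S x \<longleftrightarrow> x \<in> S \<and> (\<forall>y\<in>S. f x \<le> f y)"

text \<open>
  If \<open>f\<close> is bounded above on \<open>S\<close>, the maximum of \<open>f\<close> is written as a supremum; on polyhedra the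
  two agree for the objectives above.  If \<open>f\<close> is unbounded above, every feasible point qualifies
  for $\epsilon > 0$, and only the optimal ones for $\epsilon = 0$.
\<close>

definition approximate_solution :: "real \<Rightarrow> ('a \<Rightarrow> real) \<Rightarrow> 'a set \<Rightarrow> 'a \<Rightarrow> bool" where
  "approximate_solution \<epsilon> f S x \<longleftrightarrow>
     x \<in> S \<and>
     (\<exists>y. optimal_solution f S y \<and>
        (if bdd_above (f ` S) then f x - f y \<le> \<epsilon> * (Sup (f ` S) - f y)
         else \<epsilon> > 0 \<or> f x = f y))"

definition inf_norm :: "real vec \<Rightarrow> real" where
  "inf_norm v = Max ((\<lambda>i. \<bar>v $ i\<bar>) ` {..<dim_vec v})"

definition proximity_distances :: "real \<Rightarrow> iqp \<Rightarrow> real set" where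
  "proximity_distances \<epsilon> P =
     {inf_norm (x - d) | x d.
        optimal_solution (objective P) (iqp_feasible P) d \<and>
        approximate_solution \<epsilon> (objective P) (qp_feasible P) x}"

text \<open>
  The quantity $\delta^\star_\epsilon$.  It is the minimum of the distances exactly when it belongs
  to \<^term>\<open>proximity_distances \<epsilon> P\<close>.
\<close>

definition delta_star :: "real \<Rightarrow> iqp \<Rightarrow> real" where
  "delta_star \<epsilon> P = Inf (proximity_distances \<epsilon> P)"

text \<open>
  Non-asymptotic lower-bound notation, uniform over a parameter domain \<open>D\<close>; no filter is involved,
  in contrast to the Landau symbols of the library.
\<close>

definition in_Omega :: "'p set \<Rightarrow> ('p \<Rightarrow> real) \<Rightarrow> ('p \<Rightarrow> real) \<Rightarrow> bool" where
  "in_Omega D g h \<longleftrightarrow> (\<exists>c>0. \<exists>C>0. \<forall>p\<in>D. h p \<ge> C \<longrightarrow> g p \<ge> c * h p)"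

end

theory Submission
  imports Defs
begin

text \<open>
  The instance lives in the box $0 \le x_0$, $0 \le x_j \le \beta < 1$ for $j \ge 1$, cut by
  $x_0 - \Delta \sum_{j \ge 1} x_j \le b$, and its objective $2 c x_0 - x_0^2$ depends on $x_0$
  only.  Integrality forces $x_j = 0$ for $j \ge 1$, hence $x_0 \le b < 2 c$, where the objective
  is nonnegative and vanishes only at the origin.  The continuous problem gains up to
  $(n - 1) \Delta \beta$ in the range of $x_0$, reaches values of $x_0$ beyond $2 c$, and therefore
  has its minimum at the opposite end of the range.  If the excess over $2 c$ is large compared
  with $\epsilon c$, no point with $x_0 \le 2 c$ is an $\epsilon$-approximate solution.
\<close>

section \<open>Determinants of matrices with a single large row\<close>

text \<open>In the Leibniz expansion, every row other than \<open>r\<close> has at most one nonzero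
  entry, so all permutations with a nonzero term agree off \<open>r\<close>. A permutation is
  determined by its values off one point, hence at most one term survives, and its only factor that
  may exceed 1 in absolute value comes from row \<open>r\<close>.\<close>

lemma abs_det_le_of_unit_rows:
  fixes B :: "int mat"
  assumes B: "B \<in> carrier_mat k k" and D: "1 \<le> D"
    and entries: "\<And>j. r < k \<Longrightarrow> j < k \<Longrightarrow> \<bar>B $$ (r, j)\<bar> \<le> D"
    and unit: "\<And>i j. i < k \<Longrightarrow> j < k \<Longrightarrow> i \<noteq> r \<Longrightarrow> \<bar>B $$ (i, j)\<bar> \<le> 1"
    and single: "\<And>i j j'. i < k \<Longrightarrow> j < k \<Longrightarrow> j' < k \<Longrightarrow> i \<noteq> r \<Longrightarrow>
      B $$ (i, j) \<noteq> 0 \<Longrightarrow> B $$ (i, j') \<noteq> 0 \<Longrightarrow> j = j'"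
  shows "\<bar>det B\<bar> \<le> D"
proof -
  let ?P = "{p. p permutes {0..<k}}"
  let ?t = "\<lambda>p. signof p * (\<Prod>i = 0..<k. B $$ (i, p i))"
  have det: "det B = sum ?t ?P"
    using B by (simp add: det_def)
  have bound: "\<bar>?t p\<bar> \<le> D" if p: "p \<in> ?P" for p
  proof -
    have lt: "p i < k" if "i < k" for i
      using p that permutes_in_image[of p "{0..<k}" i] by simp
    have "\<bar>?t p\<bar> = (\<Prod>i = 0..<k. \<bar>B $$ (i, p i)\<bar>)"
      by (simp add: abs_mult abs_prod sign_def)
    also have "\<dots> \<le> (\<Prod>i = 0..<k. if i = r then D else 1)"
      using lt entries unit by (intro prod_mono) auto
    \<comment> \<open>The product is \<open>D\<close> if \<open>r < k\<close> and 1 otherwise;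
      \<open>1 \<le> D\<close> covers the second case.\<close>
    also have "\<dots> \<le> D"
      using D by (simp add: prod.delta)
    finally show ?thesis .
  qed
  have uniq: "p = q" if p: "p \<in> ?P" "?t p \<noteq> 0" and q: "q \<in> ?P" "?t q \<noteq> 0" for p q
  proof -
    have pk: "p i < k" and qk: "q i < k" if "i < k" for i
      using p(1) q(1) that permutes_in_image[of p "{0..<k}" i] permutes_in_image[of q "{0..<k}" i]
      by simp_all
    have off: "p i = q i" if "i \<noteq> r" for i
    proof (cases "i < k")
      case True
      then show ?thesis
        using p(2) q(2) pk qk single[of i "p i" "q i"] that by simp
    next
      case False
      then show ?thesis
        using p(1) q(1) by (simp add: permutes_def)
    qed
    \<comment> \<open>If the values differed, the \<open>q\<close>-preimage \<open>i\<close> of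
      \<open>p r\<close> would not be \<open>r\<close>, so \<open>p i = q i = p r\<close>, against
      injectivity of \<open>p\<close>.\<close>
    have "p r = q r"
    proof (rule ccontr)
      assume neq: "p r \<noteq> q r"
      have "surj q" "inj p"
        using p(1) q(1) by (auto dest: permutes_surj permutes_inj)
      then obtain i where i: "q i = p r"
        by (metis surjD)
      then have "i \<noteq> r"
        using neq by auto
      then show False
        using off[of i] i \<open>inj p\<close> by (auto dest: injD)
    qed
    then show ?thesis
      using off by (metis ext)
  qed
  show ?thesis
  proof (cases "\<exists>p\<in>?P. ?t p \<noteq> 0")
    case True
    then obtain p where p: "p \<in> ?P" "?t p \<noteq> 0"
      by blast
    have "sum ?t ?P = sum ?t {p}"
      using p uniq by (intro sum.mono_neutral_right) (auto simp: finite_permutations)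
    then show ?thesis
      using det bound[OF p(1)] by simp
  next
    case False
    then have "sum ?t ?P = 0"
      by (intro sum.neutral) blast
    then show ?thesis
      using det D by simp
  qed
qed

section \<open>The instance and its subdeterminants\<close>

text \<open>Row 0 is the coupling constraint, rows 1 to \<open>n - 1\<close> are the upper bounds on
  the coordinates other than 0, and rows \<open>n\<close> to \<open>2 * n - 1\<close> express
  nonnegativity.\<close>

definition gap_matrix :: "nat \<Rightarrow> int \<Rightarrow> int mat" where
  "gap_matrix n \<Delta> = mat (2 * n) n (\<lambda>(i, j).
     if i = 0 then (if j = 0 then 1 else - \<Delta>)
     else if i < n then (if j = i then 1 else 0)
     else (if j = i - n then - 1 else 0))"

text \<open>The real parameters enter only the linear term and the right-hand side, so they can be
  tuned freely without affecting the subdeterminants.\<close>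

definition gap_instance :: "nat \<Rightarrow> int \<Rightarrow> real \<Rightarrow> real \<Rightarrow> real \<Rightarrow> iqp" where
  "gap_instance n \<Delta> \<beta> b c =
     \<lparr>quad = vec 1 (\<lambda>_. 1),
      lin = vec n (\<lambda>j. if j = 0 then 2 * c else 0),
      cmat = gap_matrix n \<Delta>,
      rhs = vec (2 * n) (\<lambda>i. if i = 0 then b else if i < n then \<beta> else 0)\<rparr>"

lemma iqp_instance_gap_instance:
  "1 \<le> n \<Longrightarrow> iqp_instance n 1 (gap_instance n \<Delta> \<beta> b c)"
  by (auto simp: iqp_instance_def gap_instance_def gap_matrix_def)

text \<open>All rows except row 0 are signed unit vectors, and submatrices inherit this shape up to
  zero rows, so \<open>abs_det_le_of_unit_rows\<close> bounds every subdeterminant. The bound is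
  attained by a single entry of row 0.\<close>

lemma has_subdeterminant_gap_instance:
  assumes n: "2 \<le> n" and \<Delta>: "1 \<le> \<Delta>"
  shows "has_subdeterminant (gap_instance n \<Delta> \<beta> b c) \<Delta>"
proof -
  let ?A = "gap_matrix n \<Delta>"
  have dim: "dim_row ?A = 2 * n" "dim_col ?A = n"
    by (simp_all add: gap_matrix_def)
  have A_le: "\<bar>?A $$ (i, j)\<bar> \<le> \<Delta>" if "i < 2 * n" "j < n" for i j
    using that \<Delta> by (auto simp: gap_matrix_def)
  have A_unit: "\<bar>?A $$ (i, j)\<bar> \<le> 1" if "i < 2 * n" "j < n" "i \<noteq> 0" for i j
    using that by (auto simp: gap_matrix_def)
  have A_single: "j = j'"
    if "i < 2 * n" "j < n" "j' < n" "i \<noteq> 0" "?A $$ (i, j) \<noteq> 0" "?A $$ (i, j') \<noteq> 0" for i j j'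
    using that by (auto simp: gap_matrix_def split: if_splits)
  have le: "\<bar>det (submatrix ?A I J)\<bar> \<le> \<Delta>"
    if I: "I \<subseteq> {..<2 * n}" and J: "J \<subseteq> {..<n}" and IJ: "card I = card J" for I J
  proof -
    \<comment> \<open>\<open>submatrix\<close> computes its dimensions from these sets, which are
      just \<open>I\<close> and \<open>J\<close>.\<close>
    have card: "card {i. i < 2 * n \<and> i \<in> I} = card I" "card {j. j < n \<and> j \<in> J} = card I"
    proof -
      have "{i. i < 2 * n \<and> i \<in> I} = I" "{j. j < n \<and> j \<in> J} = J"
        using I J by auto
      then show "card {i. i < 2 * n \<and> i \<in> I} = card I" "card {j. j < n \<and> j \<in> J} = card I"
        using IJ by simp_all
    qed
    have row: "pick I i < 2 * n" if "i < card I" for i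
      using that I pick_in_set_le[of i I] by blast
    have col: "pick J j < n" if "j < card I" for j
      using that J IJ pick_in_set_le[of j J] by auto
    \<comment> \<open>\<open>pick\<close> is strictly increasing, so row 0 of the big matrix can
      only land in row 0 of the submatrix; this is why \<open>r = 0\<close> works below.\<close>
    have pos: "pick I i \<noteq> 0" if "0 < i" "i < card I" for i
      using that pick_mono_le[of i I 0] by auto
    have inj: "j = j'" if "j < card I" "j' < card I" "pick J j = pick J j'" for j j'
      using that IJ by (metis pick_mono_le nat_neq_iff)
    let ?B = "submatrix ?A I J"
    have B: "?B \<in> carrier_mat (card I) (card I)"
      using card by (auto simp: dim_submatrix dim)
    have entry: "?B $$ (i, j) = ?A $$ (pick I i, pick J j)" if "i < card I" "j < card I" for i j
      using that card by (intro submatrix_index) (simp_all add: dim)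
    show ?thesis
    proof (rule abs_det_le_of_unit_rows[OF B \<Delta>, where r = 0])
      show "\<bar>?B $$ (0, j)\<bar> \<le> \<Delta>" if "0 < card I" "j < card I" for j
        using A_le[OF row col] that by (simp only: entry)
    next
      show "\<bar>?B $$ (i, j)\<bar> \<le> 1" if "i < card I" "j < card I" "i \<noteq> 0" for i j
        using A_unit[OF row col pos] that by (simp only: entry neq0_conv)
    next
      show "j = j'"
        if "i < card I" "j < card I" "j' < card I" "i \<noteq> 0" "?B $$ (i, j) \<noteq> 0" "?B $$ (i, j') \<noteq> 0"
        for i j j'
      proof (rule inj)
        show "pick J j = pick J j'"
          using that by (intro A_single[of "pick I i"]) (simp_all only: entry row col pos neq0_conv not_False_eq_True)
      qed (use that in auto)
    qed
  qed
  have "\<Delta> \<in> abs ` subdeterminants ?A"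
  proof -
    \<comment> \<open>Column 1 exists because \<open>2 \<le> n\<close>; its entry in row 0 is
      \<open>- \<Delta>\<close>.\<close>
    let ?B = "submatrix ?A {0} {1}"
    have c: "card {i. i < 2 * n \<and> i \<in> {0::nat}} = 1" "card {j. j < n \<and> j \<in> {1::nat}} = 1"
    proof -
      have "{i. i < 2 * n \<and> i \<in> {0::nat}} = {0}" "{j. j < n \<and> j \<in> {1::nat}} = {1}"
        using n by auto
      then show "card {i. i < 2 * n \<and> i \<in> {0::nat}} = 1" "card {j. j < n \<and> j \<in> {1::nat}} = 1"
        by simp_all
    qed
    have B: "?B \<in> carrier_mat 1 1"
      using c by (auto simp: dim_submatrix dim)
    have pick: "pick {0} 0 = (0::nat)" "pick {1} 0 = (1::nat)"
      using pick_in_set_le[of 0 "{0::nat}"] pick_in_set_le[of 0 "{1::nat}"] by simp_all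
    have "?B $$ (0, 0) = ?A $$ (pick {0} 0, pick {1} 0)"
      using c by (intro submatrix_index) (simp_all add: dim)
    also have "\<dots> = - \<Delta>"
      unfolding pick using n by (simp add: gap_matrix_def)
    finally have "\<bar>det ?B\<bar> = \<Delta>"
      using B \<Delta> by (simp add: det_single)
    moreover have "det ?B \<in> subdeterminants ?A"
      unfolding subdeterminants_def dim using n by (intro CollectI exI[of _ "{0}"] exI[of _ "{1}"] conjI) auto
    ultimately show ?thesis
      by (metis image_eqI)
  qed
  then show ?thesis
    using le by (auto simp: has_subdeterminant_def subdeterminants_def gap_instance_def dim)
qed

section \<open>Coordinate form of the objective, the constraints and the norm\<close>

text \<open>Completing the square turns comparisons of objective values into comparisons of the
  distance of \<open>x $ 0\<close> from \<open>c\<close>.\<close>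

lemma objective_gap_instance:
  assumes "x \<in> carrier_vec n" "1 \<le> n"
  shows "objective (gap_instance n \<Delta> \<beta> b c) x = c\<^sup>2 - (x $ 0 - c)\<^sup>2"
proof -
  have "vec n (\<lambda>j. if j = 0 then 2 * c else 0) \<bullet> x = (\<Sum>j = 0..<n. if j = 0 then 2 * c * x $ 0 else 0)"
    using assms unfolding scalar_prod_def by (intro sum.cong) auto
  also have "\<dots> = 2 * c * x $ 0"
    using assms by (simp add: sum.delta)
  finally show ?thesis
    unfolding objective_def gap_instance_def by (simp add: power2_eq_square algebra_simps)
qed

lemma qp_feasible_gap_instance_iff:
  assumes n: "1 \<le> n"
  shows "x \<in> qp_feasible (gap_instance n \<Delta> \<beta> b c) \<longleftrightarrow>
    x \<in> carrier_vec n \<and> x $ 0 - real_of_int \<Delta> * (\<Sum>j = 1..<n. x $ j) \<le> b \<and>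
    0 \<le> x $ 0 \<and> (\<forall>j\<in>{1..<n}. 0 \<le> x $ j \<and> x $ j \<le> \<beta>)"
proof (cases "x \<in> carrier_vec n")
  case x: True
  let ?A = "map_mat real_of_int (gap_matrix n \<Delta>)"
  let ?r = "vec (2 * n) (\<lambda>i. if i = 0 then b else if i < n then \<beta> else 0)"
  have dim: "dim_row ?A = 2 * n" "dim_col ?A = n" and dim_gap: "dim_col (gap_matrix n \<Delta>) = n"
    by (simp_all add: gap_matrix_def)
  have mult: "(?A *\<^sub>v x) $ i = (\<Sum>j = 0..<n. real_of_int (gap_matrix n \<Delta> $$ (i, j)) * x $ j)"
    if "i < 2 * n" for i
    using that x by (auto simp: scalar_prod_def dim gap_matrix_def intro!: sum.cong)
  have row0: "(?A *\<^sub>v x) $ 0 = x $ 0 - real_of_int \<Delta> * (\<Sum>j = 1..<n. x $ j)"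
  proof -
    have "(?A *\<^sub>v x) $ 0 = (\<Sum>j = 0..<n. real_of_int (gap_matrix n \<Delta> $$ (0, j)) * x $ j)"
      using n by (intro mult) simp
    also have "\<dots> = x $ 0 + (\<Sum>j = 1..<n. - real_of_int \<Delta> * x $ j)"
      using n by (simp add: sum.atLeast_Suc_lessThan gap_matrix_def)
    finally show ?thesis
      by (simp add: sum_distrib_left sum_negf)
  qed
  have upper: "(?A *\<^sub>v x) $ i = x $ i" if "0 < i" "i < n" for i
  proof -
    have "(?A *\<^sub>v x) $ i = (\<Sum>j = 0..<n. real_of_int (gap_matrix n \<Delta> $$ (i, j)) * x $ j)"
      using that by (intro mult) simp
    also have "\<dots> = (\<Sum>j = 0..<n. if j = i then x $ i else 0)"
      using that by (intro sum.cong) (auto simp: gap_matrix_def)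
    finally show ?thesis
      using that by (simp add: sum.delta)
  qed
  have lower: "(?A *\<^sub>v x) $ (n + i) = - x $ i" if "i < n" for i
  proof -
    have "(?A *\<^sub>v x) $ (n + i) = (\<Sum>j = 0..<n. real_of_int (gap_matrix n \<Delta> $$ (n + i, j)) * x $ j)"
      using that by (intro mult) simp
    also have "\<dots> = (\<Sum>j = 0..<n. if j = i then - x $ i else 0)"
      using that by (intro sum.cong) (auto simp: gap_matrix_def)
    finally show ?thesis
      using that by (simp add: sum.delta)
  qed
  have "x \<in> qp_feasible (gap_instance n \<Delta> \<beta> b c) \<longleftrightarrow> (\<forall>i<2 * n. (?A *\<^sub>v x) $ i \<le> ?r $ i)"
  proof -
    have "?A *\<^sub>v x \<le> ?r \<longleftrightarrow> (\<forall>i<2 * n. (?A *\<^sub>v x) $ i \<le> ?r $ i)"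
      by (simp only: less_eq_vec_def dim_mult_mat_vec dim dim_vec simp_thms)
    then show ?thesis
      using x by (simp only: qp_feasible_def gap_instance_def iqp.simps mem_Collect_eq dim_gap simp_thms)
  qed
  \<comment> \<open>The row indices are split into the three blocks of the matrix, the last one
    shifted by \<open>n\<close>.\<close>
  also have "\<dots> \<longleftrightarrow> (?A *\<^sub>v x) $ 0 \<le> b \<and> (\<forall>i\<in>{1..<n}. (?A *\<^sub>v x) $ i \<le> \<beta>) \<and>
      (\<forall>i<n. (?A *\<^sub>v x) $ (n + i) \<le> 0)" (is "?L \<longleftrightarrow> ?R")
  proof
    assume L: ?L
    have "(?A *\<^sub>v x) $ (n + i) \<le> 0" if "i < n" for i
      using L[rule_format, of "n + i"] that by (simp del: index_mult_mat_vec)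
    moreover have "(?A *\<^sub>v x) $ i \<le> \<beta>" if "i \<in> {1..<n}" for i
      using L[rule_format, of i] that by (simp del: index_mult_mat_vec)
    ultimately show ?R
      using L[rule_format, of 0] n by (simp del: index_mult_mat_vec)
  next
    assume R: ?R
    show ?L
    proof (intro allI impI)
      fix i
      assume i: "i < 2 * n"
      show "(?A *\<^sub>v x) $ i \<le> ?r $ i"
      proof (cases "i < n")
        case True
        then show ?thesis
          using R i by (cases "i = 0") (simp_all del: index_mult_mat_vec)
      next
        case False
        then have "i - n < n"
          using i by simp
        then have "(?A *\<^sub>v x) $ (n + (i - n)) \<le> 0"
          using R by blast
        then show ?thesis
          using False i n by (simp del: index_mult_mat_vec)
      qed
    qed
  qed
  also have "\<dots> \<longleftrightarrow> x $ 0 - real_of_int \<Delta> * (\<Sum>j = 1..<n. x $ j) \<le> b \<and>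
      (\<forall>i\<in>{1..<n}. x $ i \<le> \<beta>) \<and> (\<forall>i<n. 0 \<le> x $ i)"
    using row0 upper lower by (simp del: index_mult_mat_vec)
  also have "(\<forall>i<n. 0 \<le> x $ i) \<longleftrightarrow> 0 \<le> x $ 0 \<and> (\<forall>i\<in>{1..<n}. 0 \<le> x $ i)"
    using n by (auto simp: Suc_le_eq)
  finally show ?thesis
    using x by blast
next
  case False
  then show ?thesis
    by (simp add: qp_feasible_def gap_instance_def gap_matrix_def)
qed

lemma abs_index_le_inf_norm: "i < dim_vec v \<Longrightarrow> \<bar>v $ i\<bar> \<le> inf_norm v"
  by (simp add: inf_norm_def)

lemma inf_norm_eqI:
  assumes "i < dim_vec v" "\<bar>v $ i\<bar> = a" "\<And>j. j < dim_vec v \<Longrightarrow> \<bar>v $ j\<bar> \<le> a"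
  shows "inf_norm v = a"
  using assms unfolding inf_norm_def by (intro Max_eqI) auto

section \<open>Optimal and approximate solutions of the instance\<close>

text \<open>The lower bounds on \<open>\<beta>\<close> and \<open>b\<close> make the origin
  feasible; \<open>\<beta> < 1\<close> and \<open>b < 2 * c\<close> keep integer points at
  \<open>x $ 0 < 2 * c\<close>; \<open>excess\<close> puts the top of the continuous range farther
  from \<open>c\<close> than 0 is.\<close>

locale gap =
  fixes n :: nat and \<Delta> :: int and \<beta> b c :: real
  assumes n: "2 \<le> n" and \<Delta>: "1 \<le> \<Delta>" and \<beta>: "0 \<le> \<beta>" "\<beta> < 1" and b: "0 \<le> b" "b < 2 * c"
    and excess: "2 * c < b + (real n - 1) * real_of_int \<Delta> * \<beta>"
begin

abbreviation "P \<equiv> gap_instance n \<Delta> \<beta> b c"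

text \<open>The largest continuous value of coordinate 0, reached when all other coordinates equal
  \<open>\<beta>\<close>.\<close>

definition "top_end = b + (real n - 1) * real_of_int \<Delta> * \<beta>"

text \<open>With the other coordinates at \<open>\<beta>\<close>, the coupling constraint on
  coordinate 0 is weakest, so this segment realizes every attainable value \<open>t\<close>.\<close>

definition "slice t = vec n (\<lambda>j. if j = 0 then t else \<beta>)"

lemma c_pos: "0 < c"
  using b by linarith

lemma objective_P: "x \<in> qp_feasible P \<Longrightarrow> objective P x = c\<^sup>2 - (x $ 0 - c)\<^sup>2"
  using n by (simp add: objective_gap_instance qp_feasible_gap_instance_iff)

lemma slice_0: "slice t $ 0 = t"
  using n by (simp add: slice_def)

lemma slice_feasible:
  assumes "0 \<le> t" "t \<le> top_end"
  shows "slice t \<in> qp_feasible P"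
proof -
  have "(\<Sum>j = 1..<n. slice t $ j) = (real n - 1) * \<beta>"
    using n by (simp add: slice_def of_nat_diff)
  then have "slice t $ 0 - real_of_int \<Delta> * (\<Sum>j = 1..<n. slice t $ j) \<le> b"
    using assms(2) by (simp add: slice_0 top_end_def mult.assoc mult.left_commute)
  then show ?thesis
    using n \<beta> assms(1) by (simp add: qp_feasible_gap_instance_iff slice_0) (simp add: slice_def)
qed

lemma feasible_range:
  assumes "x \<in> qp_feasible P"
  shows "0 \<le> x $ 0" "x $ 0 \<le> top_end"
proof -
  have x: "x $ 0 - real_of_int \<Delta> * (\<Sum>j = 1..<n. x $ j) \<le> b"
      "\<And>j. j \<in> {1..<n} \<Longrightarrow> x $ j \<le> \<beta>"
    using assms n by (simp_all add: qp_feasible_gap_instance_iff)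
  have "(\<Sum>j = 1..<n. x $ j) \<le> (\<Sum>j = 1..<n. \<beta>)"
    using x(2) by (intro sum_mono)
  also have "\<dots> = (real n - 1) * \<beta>"
    using n by (simp add: of_nat_diff)
  finally have "real_of_int \<Delta> * (\<Sum>j = 1..<n. x $ j) \<le> real_of_int \<Delta> * ((real n - 1) * \<beta>)"
    using \<Delta> by (intro mult_left_mono) auto
  then show "x $ 0 \<le> top_end"
    using x(1) by (simp add: top_end_def algebra_simps)
  show "0 \<le> x $ 0"
    using assms n by (simp add: qp_feasible_gap_instance_iff)
qed

text \<open>Uniqueness of the integer optimum, and its being the origin, reduces the proximity
  distances to norms of approximate solutions.\<close>

lemma optimal_iqp_iff: "optimal_solution (objective P) (iqp_feasible P) d \<longleftrightarrow> d = 0\<^sub>v n"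
proof -
  have zero: "0\<^sub>v n \<in> iqp_feasible P"
    using n b \<beta> by (simp add: iqp_feasible_def qp_feasible_gap_instance_iff)
  then have zero_value: "objective P (0\<^sub>v n) = 0"
    using n objective_P[of "0\<^sub>v n"] by (simp add: iqp_feasible_def)
  have nonneg: "0 \<le> objective P x" "objective P x = 0 \<Longrightarrow> x = 0\<^sub>v n" if x: "x \<in> iqp_feasible P" for x
  proof -
    have feas: "x \<in> qp_feasible P" and int: "\<And>i. i < dim_vec x \<Longrightarrow> x $ i \<in> \<int>"
      using x by (auto simp: iqp_feasible_def)
    then have q: "x \<in> carrier_vec n" "x $ 0 - real_of_int \<Delta> * (\<Sum>j = 1..<n. x $ j) \<le> b" "0 \<le> x $ 0"
      "\<And>j. j \<in> {1..<n} \<Longrightarrow> 0 \<le> x $ j \<and> x $ j \<le> \<beta>"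
      using n by (simp_all add: qp_feasible_gap_instance_iff)
    have rest: "x $ j = 0" if j: "j \<in> {1..<n}" for j
    proof -
      have "x $ j \<in> \<int>"
        using int[of j] j q(1) by auto
      then obtain z :: int where "x $ j = of_int z"
        by (auto elim: Ints_cases)
      then show ?thesis
        using q(4)[OF j] \<beta> by auto
    qed
    then have x0: "x $ 0 < 2 * c"
      using q(2) b by simp
    \<comment> \<open>In factored form the second factor is positive on integer points, so the sign
      and the zeros are those of \<open>x $ 0\<close>.\<close>
    have eq: "objective P x = x $ 0 * (2 * c - x $ 0)"
      using objective_P[OF feas] by (simp add: power2_eq_square algebra_simps)
    show "0 \<le> objective P x"
      using eq x0 q(3) by simp
    show "x = 0\<^sub>v n" if "objective P x = 0"
    proof (rule eq_vecI)
      have "x $ 0 = 0"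
        using that eq x0 by simp
      then show "x $ j = 0\<^sub>v n $ j" if "j < dim_vec (0\<^sub>v n)" for j
        using rest[of j] that by (cases "j = 0") auto
    qed (use q(1) in auto)
  qed
  show ?thesis
    using zero zero_value nonneg unfolding optimal_solution_def by (metis order_antisym)
qed

text \<open>The distance from \<open>c\<close> over an interval is largest at an endpoint, and by
  \<open>excess\<close> the upper endpoint is the farther one.\<close>

lemma sq_dist_le:
  assumes "0 \<le> t" "t \<le> top_end"
  shows "(t - c)\<^sup>2 \<le> (top_end - c)\<^sup>2"
  using assms excess c_pos by (intro power2_le_iff_abs_le[THEN iffD2]) (auto simp: top_end_def)

lemma optimal_qp: "optimal_solution (objective P) (qp_feasible P) (slice top_end)"
proof -
  have "0 \<le> top_end"
    using excess c_pos by (simp add: top_end_def)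
  then have "slice top_end \<in> qp_feasible P"
    using slice_feasible by simp
  then show ?thesis
    using sq_dist_le feasible_range by (simp add: optimal_solution_def objective_P slice_0)
qed

lemma Sup_objective:
  "bdd_above (objective P ` qp_feasible P)" "Sup (objective P ` qp_feasible P) = c\<^sup>2"
proof -
  have le: "y \<le> c\<^sup>2" if "y \<in> objective P ` qp_feasible P" for y
    using that by (auto simp: objective_P)
  then show "bdd_above (objective P ` qp_feasible P)"
    by (auto simp: bdd_above_def)
  \<comment> \<open>The vertex of the parabola lies in the range of coordinate 0, so the supremum is
    attained.\<close>
  have "slice c \<in> qp_feasible P"
    using slice_feasible excess c_pos by (simp add: top_end_def)
  then have "c\<^sup>2 \<in> objective P ` qp_feasible P"
    by (auto intro!: image_eqI[of _ _ "slice c"] simp: objective_P slice_0)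
  then show "Sup (objective P ` qp_feasible P) = c\<^sup>2"
    using le by (intro cSup_eq_maximum)
qed

text \<open>The values of the objective span an interval of length
  \<open>(top_end - c)\<^sup>2\<close> ending at \<open>c\<^sup>2\<close>, so the approximation
  condition becomes a lower bound on the distance of \<open>x $ 0\<close> from
  \<open>c\<close>.\<close>

lemma approximate_qp_iff:
  "approximate_solution \<epsilon> (objective P) (qp_feasible P) x \<longleftrightarrow>
     x \<in> qp_feasible P \<and> (1 - \<epsilon>) * (top_end - c)\<^sup>2 \<le> (x $ 0 - c)\<^sup>2"
proof -
  \<comment> \<open>The definition refers to some optimum \<open>y\<close>; all optima share one
    value, so the choice does not matter.\<close>
  have opt: "objective P y = c\<^sup>2 - (top_end - c)\<^sup>2"
    if "optimal_solution (objective P) (qp_feasible P) y" for y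
  proof -
    have "objective P y = objective P (slice top_end)"
      using that optimal_qp by (auto simp: optimal_solution_def intro: antisym)
    then show ?thesis
      using optimal_qp by (simp add: optimal_solution_def objective_P slice_0)
  qed
  have "approximate_solution \<epsilon> (objective P) (qp_feasible P) x \<longleftrightarrow> x \<in> qp_feasible P \<and>
      objective P x - (c\<^sup>2 - (top_end - c)\<^sup>2) \<le> \<epsilon> * (c\<^sup>2 - (c\<^sup>2 - (top_end - c)\<^sup>2))"
    unfolding approximate_solution_def using Sup_objective opt optimal_qp by auto
  then show ?thesis
    by (auto simp: objective_P algebra_simps)
qed

text \<open>Approximate solutions satisfy \<open>\<bar>x $ 0 - c\<bar> \<ge> s\<close> with
  \<open>s = sqrt (1 - \<epsilon>) * (top_end - c)\<close>. Since \<open>c < s\<close>, the branch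
  \<open>x $ 0 \<le> c - s\<close> is negative and infeasible, leaving
  \<open>x $ 0 \<ge> c + s\<close>, which a point of the segment attains.\<close>

lemma delta_star_P:
  assumes \<epsilon>: "0 \<le> \<epsilon>" "\<epsilon> \<le> 1" and c: "1 \<le> c" and sep: "c < sqrt (1 - \<epsilon>) * (top_end - c)"
  shows "delta_star \<epsilon> P \<in> proximity_distances \<epsilon> P"
    and "delta_star \<epsilon> P = c + sqrt (1 - \<epsilon>) * (top_end - c)"
proof -
  define s where "s = sqrt (1 - \<epsilon>) * (top_end - c)"
  have s2: "(1 - \<epsilon>) * (top_end - c)\<^sup>2 = s\<^sup>2"
    using \<epsilon> by (simp add: s_def power_mult_distrib)
  have top: "c \<le> top_end"
    using excess c_pos by (simp add: top_end_def)
  have "s \<le> 1 * (top_end - c)"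
    unfolding s_def using \<epsilon> top by (intro mult_right_mono) auto
  then have s_le: "c + s \<le> top_end"
    by simp
  have s: "c < s"
    using sep by (simp add: s_def)
  have dist: "proximity_distances \<epsilon> P =
      {inf_norm x |x. x \<in> qp_feasible P \<and> s\<^sup>2 \<le> (x $ 0 - c)\<^sup>2}"
  proof -
    have "x - 0\<^sub>v n = x" if "x \<in> qp_feasible P" for x
      using that n by (intro minus_zero_vec) (simp add: qp_feasible_gap_instance_iff)
    then show ?thesis
      unfolding proximity_distances_def optimal_iqp_iff approximate_qp_iff s2 by force
  qed
  have mem: "c + s \<in> proximity_distances \<epsilon> P"
  proof -
    \<comment> \<open>The remaining coordinates equal \<open>\<beta> < 1 \<le> c\<close>, so
      coordinate 0 determines the norm.\<close>
    have "inf_norm (slice (c + s)) = c + s"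
      using n \<beta> c s by (intro inf_norm_eqI[of 0]) (auto simp: slice_def)
    moreover have "slice (c + s) \<in> qp_feasible P"
      using slice_feasible s_le s c by simp
    ultimately show ?thesis
      unfolding dist by (auto intro!: exI[of _ "slice (c + s)"] simp: slice_0)
  qed
  have min: "c + s \<le> r" if r: "r \<in> proximity_distances \<epsilon> P" for r
  proof -
    obtain x where x: "r = inf_norm x" "x \<in> qp_feasible P" "s\<^sup>2 \<le> (x $ 0 - c)\<^sup>2"
      using r unfolding dist by blast
    have "s \<le> \<bar>x $ 0 - c\<bar>"
      using x(3) s c by (simp add: abs_le_square_iff[symmetric])
    then have "c + s \<le> \<bar>x $ 0\<bar>"
      using feasible_range(1)[OF x(2)] s by linarith
    also have "\<dots> \<le> inf_norm x"
      using x(2) n by (intro abs_index_le_inf_norm) (auto simp: qp_feasible_gap_instance_iff)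
    finally show ?thesis
      by (simp add: x(1))
  qed
  have eq: "delta_star \<epsilon> P = c + s"
    unfolding delta_star_def using mem min by (rule cInf_eq_minimum)
  show "delta_star \<epsilon> P \<in> proximity_distances \<epsilon> P"
    using mem eq by simp
  show "delta_star \<epsilon> P = c + sqrt (1 - \<epsilon>) * (top_end - c)"
    using eq by (simp add: s_def)
qed

end

section \<open>Choice of the parameters\<close>

lemma gap_instance_exists:
  assumes n: "2 \<le> n" and \<Delta>: "2 \<le> \<Delta>" and \<epsilon>: "0 < \<epsilon>" "\<epsilon> < 1 / 2"
  shows "\<exists>P. iqp_instance n 1 P \<and> has_subdeterminant P \<Delta> \<and>
    (\<exists>d. optimal_solution (objective P) (iqp_feasible P) d) \<and>
    (\<exists>x. optimal_solution (objective P) (qp_feasible P) x) \<and>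
    delta_star \<epsilon> P \<in> proximity_distances \<epsilon> P \<and>
    ((real n - 1) * real_of_int \<Delta> - 1) / \<epsilon> \<le> delta_star \<epsilon> P"
proof -
  define M where "M = (real n - 1) * real_of_int \<Delta>"
  \<comment> \<open>The excess of the top end over \<open>2 * c\<close> is \<open>E\<close>, and \<open>c\<close> makes \<open>top_end - c = E / \<epsilon>\<close>.\<close>
  define E where "E = M - 1"
  define c where "c = E / \<epsilon> - E"
  \<comment> \<open>\<open>b\<close> stays 1/2 below \<open>2 * c\<close>, and
    \<open>\<beta>\<close> stays below 1 by just enough to cost another 1/2 in
    \<open>M * \<beta>\<close>; together these make the excess \<open>M - 1\<close>.\<close>
  define b where "b = 2 * c - 1 / 2"
  define \<beta> where "\<beta> = 1 - 1 / (2 * M)"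
  have "1 * 2 \<le> M"
    unfolding M_def using n \<Delta> by (intro mult_mono) auto
  then have M: "2 \<le> M"
    by simp
  then have E: "1 \<le> E"
    by (simp add: E_def)
  \<comment> \<open>Here \<open>\<epsilon> < 1 / 2\<close> enters: it gives
    \<open>E \<le> E / \<epsilon> - E = c\<close>, so
    \<open>2 * c = E / \<epsilon> + (c - E)\<close> is at least
    \<open>E / \<epsilon>\<close>.\<close>
  have half: "E / \<epsilon> \<le> 2 * c" and c: "1 \<le> c"
  proof -
    have "2 * E \<le> E / \<epsilon>"
      using E \<epsilon> by (simp add: field_simps)
    then show "E / \<epsilon> \<le> 2 * c" "1 \<le> c"
      using E by (simp_all add: c_def)
  qed
  have "M * \<beta> = M - 1 / 2"
    using M by (simp add: \<beta>_def field_simps)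
  then have top: "b + M * \<beta> = 2 * c + E"
    by (simp add: b_def E_def)
  interpret gap n \<Delta> \<beta> b c
  proof
    show "2 * c < b + (real n - 1) * real_of_int \<Delta> * \<beta>"
      using top E by (simp add: M_def)
  qed (use n \<Delta> M c in \<open>auto simp: \<beta>_def b_def field_simps\<close>)
  have top_end: "top_end - c = E / \<epsilon>"
    using top by (simp add: top_end_def M_def c_def)
  \<comment> \<open>As \<open>c = (1 - \<epsilon>) * (E / \<epsilon>)\<close>, the separation
    condition of \<open>delta_star_P\<close> amounts to
    \<open>1 - \<epsilon> < sqrt (1 - \<epsilon>)\<close>.\<close>
  have "(1 - \<epsilon>)\<^sup>2 < 1 - \<epsilon>"
    using \<epsilon> by (simp add: power2_eq_square)
  then have "1 - \<epsilon> < sqrt (1 - \<epsilon>)"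
    by (rule real_less_rsqrt)
  then have "(1 - \<epsilon>) * (E / \<epsilon>) < sqrt (1 - \<epsilon>) * (E / \<epsilon>)"
    using E \<epsilon> by (intro mult_strict_right_mono) auto
  then have sep: "c < sqrt (1 - \<epsilon>) * (top_end - c)"
    unfolding top_end using \<epsilon> by (simp add: c_def left_diff_distrib diff_divide_distrib)
  have \<epsilon>': "0 \<le> \<epsilon>" "\<epsilon> \<le> 1"
    using \<epsilon> by simp_all
  note delta = delta_star_P[OF \<epsilon>' c sep]
  \<comment> \<open>By \<open>sep\<close> the distance exceeds \<open>c + c\<close>, which is at
    least \<open>E / \<epsilon>\<close> by \<open>half\<close>.\<close>
  have "((real n - 1) * real_of_int \<Delta> - 1) / \<epsilon> \<le> delta_star \<epsilon> P"
    using delta(2) sep half by (simp add: E_def M_def)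
  then show ?thesis
    using n \<Delta> delta(1) optimal_iqp_iff optimal_qp iqp_instance_gap_instance[of n]
      has_subdeterminant_gap_instance[of n] by (intro exI[of _ P]) auto
qed

section \<open>The asymptotic form of the bound\<close>

text \<open>Write \<open>N\<close> for \<open>n * \<Delta>\<close>. From
  \<open>\<Delta> \<le> N / 2\<close> and \<open>1 \<le> N / 4\<close> the numerator is at least
  \<open>N / 4\<close>. Once \<open>N / \<epsilon> \<ge> 16\<close>, subtracting 2 costs at most
  \<open>N / (8 * \<epsilon>)\<close>, which leaves the constant 1/8.\<close>

lemma bound_in_Omega:
  "in_Omega {(n::nat, \<Delta>::int, \<epsilon>::real). n \<ge> 2 \<and> \<Delta> \<ge> 2 \<and> 0 < \<epsilon> \<and> \<epsilon> < 1/2}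
     (\<lambda>(n, \<Delta>, \<epsilon>). ((real n - 1) * real_of_int \<Delta> - 1) / \<epsilon> - 2)
     (\<lambda>(n, \<Delta>, \<epsilon>). real n * real_of_int \<Delta> / \<epsilon>)"
proof -
  have "(1 / 8) * (real n * real_of_int \<Delta> / \<epsilon>) \<le> ((real n - 1) * real_of_int \<Delta> - 1) / \<epsilon> - 2"
    if n: "2 \<le> n" and \<Delta>: "2 \<le> \<Delta>" and \<epsilon>: "0 < \<epsilon>"
      and large: "16 \<le> real n * real_of_int \<Delta> / \<epsilon>" for n :: nat and \<Delta> :: int and \<epsilon> :: real
  proof -
    have "2 * 2 \<le> real n * real_of_int \<Delta>"
      using n \<Delta> by (intro mult_mono) auto
    moreover have "2 * real_of_int \<Delta> \<le> real n * real_of_int \<Delta>"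
      using n \<Delta> by (intro mult_right_mono) auto
    ultimately have "real n * real_of_int \<Delta> / 4 \<le> (real n - 1) * real_of_int \<Delta> - 1"
      by (simp add: algebra_simps)
    then have "real n * real_of_int \<Delta> / 4 / \<epsilon> \<le> ((real n - 1) * real_of_int \<Delta> - 1) / \<epsilon>"
      using \<epsilon> by (intro divide_right_mono) auto
    then show ?thesis
      using large by simp
  qed
  then show ?thesis
    unfolding in_Omega_def
    by (intro exI[of _ "1 / 8"] exI[of _ 16] conjI ballI) (auto simp del: divide_divide_eq_left times_divide_eq_right)
qed

theorem proposition4:
  shows "(\<forall>(n::nat) (\<Delta>::int) (\<epsilon>::real). n \<ge> 2 \<and> \<Delta> \<ge> 2 \<and> 0 < \<epsilon> \<and> \<epsilon> < 1/2 \<longrightarrow>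
           (\<exists>P. iqp_instance n 1 P \<and> has_subdeterminant P \<Delta> \<and>
                (\<exists>d. optimal_solution (objective P) (iqp_feasible P) d) \<and>
                (\<exists>x. optimal_solution (objective P) (qp_feasible P) x) \<and>
                delta_star \<epsilon> P \<in> proximity_distances \<epsilon> P \<and>
                delta_star \<epsilon> P \<ge> ((real n - 1) * real_of_int \<Delta> - 1) / \<epsilon> - 2))
       \<and> in_Omega {(n::nat, \<Delta>::int, \<epsilon>::real). n \<ge> 2 \<and> \<Delta> \<ge> 2 \<and> 0 < \<epsilon> \<and> \<epsilon> < 1/2}
           (\<lambda>(n, \<Delta>, \<epsilon>). ((real n - 1) * real_of_int \<Delta> - 1) / \<epsilon> - 2)
           (\<lambda>(n, \<Delta>, \<epsilon>). real n * real_of_int \<Delta> / \<epsilon>)"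
proof (intro conjI allI impI)
  fix n :: nat and \<Delta> :: int and \<epsilon> :: real
  assume "n \<ge> 2 \<and> \<Delta> \<ge> 2 \<and> 0 < \<epsilon> \<and> \<epsilon> < 1/2"
  then obtain P where "iqp_instance n 1 P" "has_subdeterminant P \<Delta>"
    "\<exists>d. optimal_solution (objective P) (iqp_feasible P) d"
    "\<exists>x. optimal_solution (objective P) (qp_feasible P) x"
    "delta_star \<epsilon> P \<in> proximity_distances \<epsilon> P"
    "((real n - 1) * real_of_int \<Delta> - 1) / \<epsilon> \<le> delta_star \<epsilon> P"
    using gap_instance_exists[of n \<Delta> \<epsilon>] by blast
  then show "\<exists>P. iqp_instance n 1 P \<and> has_subdeterminant P \<Delta> \<and>
      (\<exists>d. optimal_solution (objective P) (iqp_feasible P) d) \<and>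
      (\<exists>x. optimal_solution (objective P) (qp_feasible P) x) \<and>
      delta_star \<epsilon> P \<in> proximity_distances \<epsilon> P \<and>
      delta_star \<epsilon> P \<ge> ((real n - 1) * real_of_int \<Delta> - 1) / \<epsilon> - 2"
    by (intro exI[of _ P]) auto
qed (rule bound_in_Omega)

end
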